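(* Each countable non-zero ordinal space is $CT_3$.
   Context: An ordinal $\alpha$ is identified with the set of all ordinals less than $\alpha$ and carries the order topology. For a space $X$, $\mathrm{Cld}(X)$ denotes the set of all non-empty closed subsets of $X$, endowed with the Vietoris topology, i.e. the topology having as a subbase all sets $U^-=\{F\in\mathrm{Cld}(X): F\cap U\neq\emptyset\}$ and $U^+=\{F\in\mathrm{Cld}(X): F\subseteq U\}$ with $U$ open in $X$. Let $\mathcal{T}_3(X)=\{(F_1,F_2)\in\mathrm{Cld}(X)^2: F_1\cap F_2=\emptyset,\ F_1 \text{ is a singleton}\}$, with the subspace topology from the product space $\mathrm{Cld}(X)^2$. The space $X$ is called $CT_3$ if there is a continuous map $\phi=(\phi_1,\phi_2):\mathcal{T}_3(X)\to\mathrm{Cld}(X)^2$ such that for every $(F_1,F_2)\in\mathcal{T}_3(X)$: $\phi_1(F_1,F_2)\cup\phi_2(F_1,F_2)=X$ and $F_j\cap\phi_j(F_1,F_2)=\emptyset$ for $j=1,2$. *)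

theory Defs
  imports "HOL-Analysis.Analysis"
begin

text \<open>
  An ordinal is given by a well-order relation \<open>r\<close> (\<open>Well_order r\<close>), the corresponding space
  being \<open>Field r\<close> with the order topology. The ordinal itself, seen as the set of smaller
  ordinals, is the canonical representative of the order-isomorphism class.
\<close>

text \<open>The open rays form a subbase; \<open>Field r\<close> itself is needed because the rays do not cover
  a one-element order.\<close>

definition rel_order_topology :: "'a rel \<Rightarrow> 'a topology" where
  "rel_order_topology r = topology_generated_by
     ({Field r} \<union> {underS r a |a. a \<in> Field r} \<union> {aboveS r a |a. a \<in> Field r})"

definition Cld :: "'a topology \<Rightarrow> 'a set set" where
  "Cld X = {F. closedin X F \<and> F \<noteq> {}}"

definition vietoris :: "'a topology \<Rightarrow> 'a set topology" where
  "vietoris X = topology_generated_by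
     ({{F \<in> Cld X. F \<inter> U \<noteq> {}} |U. openin X U} \<union> {{F \<in> Cld X. F \<subseteq> U} |U. openin X U})"

definition T3_pairs :: "'a topology \<Rightarrow> ('a set \<times> 'a set) set" where
  "T3_pairs X = {(F1, F2). F1 \<in> Cld X \<and> F2 \<in> Cld X \<and> F1 \<inter> F2 = {} \<and> is_singleton F1}"

definition CT3 :: "'a topology \<Rightarrow> bool" where
  "CT3 X \<longleftrightarrow> (\<exists>\<phi>1 \<phi>2 :: 'a set \<times> 'a set \<Rightarrow> 'a set.
     continuous_map
       (subtopology (prod_topology (vietoris X) (vietoris X)) (T3_pairs X))
       (prod_topology (vietoris X) (vietoris X))
       (\<lambda>p. (\<phi>1 p, \<phi>2 p)) \<and>
     (\<forall>F1 F2. (F1, F2) \<in> T3_pairs X \<longrightarrow>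
        \<phi>1 (F1, F2) \<union> \<phi>2 (F1, F2) = topspace X \<and>
        F1 \<inter> \<phi>1 (F1, F2) = {} \<and> F2 \<inter> \<phi>2 (F1, F2) = {}))"

lemma topspace_rel_order_topology: "topspace (rel_order_topology r) = Field r"
  unfolding rel_order_topology_def topology_generated_by_topspace
  unfolding underS_def aboveS_def by (auto intro: FieldI1 FieldI2)

lemma topspace_vietoris: "topspace (vietoris X) = Cld X"
proof -
  have "{F \<in> Cld X. F \<subseteq> topspace X} = Cld X"
    unfolding Cld_def using closedin_subset by blast
  then have "Cld X \<in> {{F \<in> Cld X. F \<subseteq> U} |U. openin X U}"
    by (intro CollectI exI[of _ "topspace X"]) simp
  then show ?thesis
    unfolding vietoris_def topology_generated_by_topspace by blast
qed

end

theory Submission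
  imports Defs
begin

text \<open>
  The proof selects a separating clopen set in a locally constant way. If \<open>V\<close> is clopen in \<open>X\<close>,
  then the set of pairs \<open>(F\<^sub>1, F\<^sub>2)\<close> with \<open>F\<^sub>1 \<subseteq> V\<close> and \<open>F\<^sub>2 \<inter> V = {}\<close> is clopen in \<open>T3_pairs X\<close>:
  both inclusions \<open>F\<^sub>1 \<subseteq> V\<close>, \<open>F\<^sub>2 \<subseteq> X - V\<close> and their negations, \<open>F\<^sub>1\<close> meets \<open>X - V\<close> and \<open>F\<^sub>2\<close> meets \<open>V\<close>,
  are open conditions in the Vietoris topology. Suppose that \<open>X\<close> has a countable base
  \<open>W\<^sub>0, W\<^sub>1, \<dots>\<close> of clopen sets. As \<open>F\<^sub>1\<close> is a singleton, each pair in \<open>T3_pairs X\<close> is separated by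
  some \<open>W\<^sub>n\<close>, and the least such index \<open>n\<close> is a locally constant function of the pair.
  Hence \<open>\<phi>\<^sub>1 = X - W\<^sub>n\<close> and \<open>\<phi>\<^sub>2 = W\<^sub>n\<close> are continuous, and they are non-empty because they contain
  \<open>F\<^sub>2\<close> and \<open>F\<^sub>1\<close>, respectively; so \<open>X\<close> is \<open>CT3\<close> (\<open>CT3_if_countable_clopen_base\<close>).

  In an ordinal the initial segments \<open>[0, x]\<close> are clopen, so the intervals \<open>[0, x]\<close> and \<open>(a, x]\<close> form
  a base of clopen sets (\<open>clopen_interval_base\<close>), which is countable when the ordinal is.
\<close>

section \<open>Spaces with a countable base of clopen sets\<close>

lemma openin_vietoris_subset:
  "openin X U \<Longrightarrow> openin (vietoris X) {F \<in> Cld X. F \<subseteq> U}"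
  unfolding vietoris_def by (rule topology_generated_by_Basis) blast

lemma openin_vietoris_hit:
  "openin X U \<Longrightarrow> openin (vietoris X) {F \<in> Cld X. F \<inter> U \<noteq> {}}"
  unfolding vietoris_def by (rule topology_generated_by_Basis) blast

text \<open>The subspace \<open>\<T>\<^sub>3(X)\<close> of the square of the hyperspace.\<close>

definition T3_space :: "'a topology \<Rightarrow> ('a set \<times> 'a set) topology" where
  "T3_space X = subtopology (prod_topology (vietoris X) (vietoris X)) (T3_pairs X)"

lemma topspace_T3_space: "topspace (T3_space X) = T3_pairs X"
  unfolding T3_space_def by (auto simp: topspace_vietoris T3_pairs_def)

lemma
  assumes "openin X V" and "closedin X V"
  shows openin_separated_pairs:
      "openin (T3_space X) {p \<in> T3_pairs X. fst p \<subseteq> V \<and> snd p \<inter> V = {}}" (is ?sep)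
    and openin_nonseparated_pairs:
      "openin (T3_space X) {p \<in> T3_pairs X. \<not> (fst p \<subseteq> V \<and> snd p \<inter> V = {})}" (is ?nonsep)
proof -
  let ?P = "prod_topology (vietoris X) (vietoris X)"
  let ?in = "\<lambda>U. {F \<in> Cld X. F \<subseteq> U}" and ?hit = "\<lambda>U. {F \<in> Cld X. F \<inter> U \<noteq> {}}"
  let ?C = "topspace X - V"
  have C: "openin X ?C"
    using assms(2) by blast
  have Cld: "openin (vietoris X) (Cld X)"
    by (metis openin_topspace topspace_vietoris)
  have sub: "F \<subseteq> topspace X" if "F \<in> Cld X" for F
    using that by (auto simp: Cld_def dest: closedin_subset)
  have "openin ?P (?in V \<times> ?in ?C)"
    using assms C by (simp add: openin_prod_Times_iff openin_vietoris_subset)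
  moreover have "{p \<in> T3_pairs X. fst p \<subseteq> V \<and> snd p \<inter> V = {}} = (?in V \<times> ?in ?C) \<inter> T3_pairs X"
    using sub by (fastforce simp: T3_pairs_def)
  ultimately show ?sep
    unfolding T3_space_def openin_subtopology by blast
  have "openin ?P (?hit ?C \<times> Cld X \<union> Cld X \<times> ?hit V)"
    using assms C Cld by (intro openin_Un) (simp_all add: openin_prod_Times_iff openin_vietoris_hit)
  moreover have "{p \<in> T3_pairs X. \<not> (fst p \<subseteq> V \<and> snd p \<inter> V = {})}
      = (?hit ?C \<times> Cld X \<union> Cld X \<times> ?hit V) \<inter> T3_pairs X"
    using sub by (fastforce simp: T3_pairs_def)
  ultimately show ?nonsep
    unfolding T3_space_def openin_subtopology by blast
qed

lemma openin_Least_fibre: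
  fixes P :: "nat \<Rightarrow> 'b \<Rightarrow> bool"
  assumes "\<And>n. openin T {p \<in> topspace T. P n p}"
    and "\<And>n. openin T {p \<in> topspace T. \<not> P n p}"
    and "\<And>p. p \<in> topspace T \<Longrightarrow> \<exists>n. P n p"
  shows "openin T {p \<in> topspace T. (LEAST n. P n p) = m}"
proof -
  have "openin T {p \<in> topspace T. \<forall>k\<in>{..<m}. \<not> P k p}"
  proof (induction m)
    case (Suc m)
    have "{p \<in> topspace T. \<forall>k\<in>{..<Suc m}. \<not> P k p}
        = {p \<in> topspace T. \<forall>k\<in>{..<m}. \<not> P k p} \<inter> {p \<in> topspace T. \<not> P m p}"
      by (auto simp: less_Suc_eq)
    then show ?case
      using Suc assms(2) by auto
  qed simp
  then have "openin T ({p \<in> topspace T. P m p} \<inter> {p \<in> topspace T. \<forall>k\<in>{..<m}. \<not> P k p})"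
    using assms(1) by blast
  moreover have "(LEAST n. P n p) = m \<longleftrightarrow> P m p \<and> (\<forall>k\<in>{..<m}. \<not> P k p)"
    if p: "p \<in> topspace T" for p
  proof
    show "P m p \<and> (\<forall>k\<in>{..<m}. \<not> P k p)" if "(LEAST n. P n p) = m"
      using that LeastI_ex[OF assms(3)[OF p]] by (auto dest: not_less_Least)
    show "(LEAST n. P n p) = m" if "P m p \<and> (\<forall>k\<in>{..<m}. \<not> P k p)"
      using that by (intro Least_equality) (auto simp: not_less[symmetric])
  qed
  then have "{p \<in> topspace T. (LEAST n. P n p) = m}
      = {p \<in> topspace T. P m p} \<inter> {p \<in> topspace T. \<forall>k\<in>{..<m}. \<not> P k p}"
    by blast
  ultimately show ?thesis
    by simp
qed

lemma continuous_map_if_open_fibres: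
  assumes "\<And>m. openin T {p \<in> topspace T. n p = m}"
    and "\<And>p. p \<in> topspace T \<Longrightarrow> g (n p) \<in> topspace Y"
  shows "continuous_map T Y (\<lambda>p. g (n p))"
  unfolding continuous_map
proof (intro conjI allI impI)
  show "(\<lambda>p. g (n p)) ` topspace T \<subseteq> topspace Y"
    using assms(2) by blast
  fix U
  have "{p \<in> topspace T. g (n p) \<in> U} = (\<Union>m\<in>{m. g m \<in> U}. {p \<in> topspace T. n p = m})"
    by blast
  then show "openin T {p \<in> topspace T. g (n p) \<in> U}"
    using assms(1) by auto
qed

lemma CT3_if_countable_clopen_base:
  assumes "countable B"
    and clopen: "\<And>V. V \<in> B \<Longrightarrow> openin X V \<and> closedin X V"
    and base: "\<And>U x. openin X U \<Longrightarrow> x \<in> U \<Longrightarrow> \<exists>V\<in>B. x \<in> V \<and> V \<subseteq> U"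
  shows "CT3 X"
proof -
  (* Inserting the empty set makes the family enumerable even when B is empty. *)
  obtain W :: "nat \<Rightarrow> 'a set" where W: "insert {} B = range W"
    using uncountable_def[of "insert {} B"] \<open>countable B\<close> by auto
  have "openin X V \<and> closedin X V" if "V \<in> insert {} B" for V
    using clopen that by auto
  then have W_clopen: "openin X (W k)" "closedin X (W k)" for k
    unfolding W by auto
  define sep where "sep = (\<lambda>k p. fst p \<subseteq> W k \<and> snd p \<inter> W k = {})"
  define n where "n = (\<lambda>p. LEAST k. sep k p)"
  have ex: "\<exists>k. sep k p" if p: "p \<in> T3_pairs X" for p
  proof -
    obtain x F where xF: "p = ({x}, F)" "{x} \<in> Cld X" "F \<in> Cld X" "x \<notin> F"
      using p by (auto simp: T3_pairs_def is_singleton_def)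
    then have "openin X (topspace X - F)" "x \<in> topspace X - F"
      by (auto simp: Cld_def dest: closedin_subset)
    then obtain V where "V \<in> B" "x \<in> V" "V \<subseteq> topspace X - F"
      using base by blast
    moreover obtain k where "V = W k"
      using W \<open>V \<in> B\<close> by blast
    ultimately show ?thesis
      unfolding sep_def xF by auto
  qed
  have sep_n: "sep (n p) p" if "p \<in> T3_pairs X" for p
    unfolding n_def using ex[OF that] by (rule LeastI_ex)
  have fibres: "openin (T3_space X) {p \<in> topspace (T3_space X). n p = m}" for m
    unfolding n_def
  proof (rule openin_Least_fibre)
    fix k
    show "openin (T3_space X) {p \<in> topspace (T3_space X). sep k p}"
      unfolding topspace_T3_space sep_def by (rule openin_separated_pairs[OF W_clopen])
    show "openin (T3_space X) {p \<in> topspace (T3_space X). \<not> sep k p}"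
      unfolding topspace_T3_space sep_def by (rule openin_nonseparated_pairs[OF W_clopen])
  qed (simp add: ex topspace_T3_space)
  have Cld: "topspace X - W (n p) \<in> Cld X" "W (n p) \<in> Cld X" if p: "p \<in> T3_pairs X" for p
  proof -
    have "fst p \<noteq> {}" "snd p \<noteq> {}" "snd p \<subseteq> topspace X"
      using p closedin_subset[of X "snd p"] by (auto simp: T3_pairs_def Cld_def)
    then have "topspace X - W (n p) \<noteq> {}" "W (n p) \<noteq> {}"
      using sep_n[OF p] unfolding sep_def by blast+
    then show "topspace X - W (n p) \<in> Cld X" "W (n p) \<in> Cld X"
      using W_clopen by (auto simp: Cld_def)
  qed
  have "continuous_map (T3_space X) (vietoris X) (\<lambda>p. topspace X - W (n p))"
    using fibres Cld(1)
    by (intro continuous_map_if_open_fibres[where g = "\<lambda>k. topspace X - W k"])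
      (simp_all add: topspace_vietoris topspace_T3_space)
  moreover have "continuous_map (T3_space X) (vietoris X) (\<lambda>p. W (n p))"
    using fibres Cld(2)
    by (intro continuous_map_if_open_fibres) (simp_all add: topspace_vietoris topspace_T3_space)
  ultimately have cont: "continuous_map (T3_space X) (prod_topology (vietoris X) (vietoris X))
      (\<lambda>p. (topspace X - W (n p), W (n p)))"
    by (simp add: continuous_map_paired)
  show ?thesis
    unfolding CT3_def
  proof (intro exI conjI allI impI)
    show "continuous_map
        (subtopology (prod_topology (vietoris X) (vietoris X)) (T3_pairs X))
        (prod_topology (vietoris X) (vietoris X)) (\<lambda>p. (topspace X - W (n p), W (n p)))"
      using cont unfolding T3_space_def .
    fix F1 F2 assume "(F1, F2) \<in> T3_pairs X"
    from sep_n[OF this] have "F1 \<subseteq> W (n (F1, F2))" "F2 \<inter> W (n (F1, F2)) = {}"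
      by (simp_all add: sep_def)
    then show "(topspace X - W (n (F1, F2))) \<union> W (n (F1, F2)) = topspace X"
      "F1 \<inter> (topspace X - W (n (F1, F2))) = {}" "F2 \<inter> W (n (F1, F2)) = {}"
      using openin_subset[OF W_clopen(1)] by blast+
  qed
qed

section \<open>Clopen intervals in well-orders\<close>

lemma clopen_under:
  assumes "Well_order r" and b: "b \<in> Field r"
  shows "openin (rel_order_topology r) (under r b)"
    and "closedin (rel_order_topology r) (under r b)"
proof -
  have wo: "wo_rel r"
    using assms(1) by (simp add: wo_rel_def)
  note TOTALS = wo_rel.TOTALS[OF wo] and ANTISYM = wo_rel.ANTISYM[OF wo] and REFL = wo_rel.REFL[OF wo] and TRANS = wo_rel.TRANS[OF wo]
  let ?X = "rel_order_topology r"
  have gen: "openin ?X S"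
    if "S \<in> {Field r} \<union> {underS r a |a. a \<in> Field r} \<union> {aboveS r a |a. a \<in> Field r}" for S
    using that unfolding rel_order_topology_def by (rule topology_generated_by_Basis)
  have compl: "Field r - under r b = aboveS r b"
    using b TOTALS ANTISYM REFL
    by (auto simp: under_def aboveS_def antisym_def refl_on_def intro: FieldI2)
  have "openin ?X (aboveS r b)"
    using b by (intro gen) blast
  then show "closedin ?X (under r b)"
    by (simp add: closedin_def topspace_rel_order_topology compl under_Field)
  show "openin ?X (under r b)"
  proof (cases "aboveS r b = {}")
    case True
    then have "under r b = Field r"
      using compl under_Field[of r b] by blast
    then show ?thesis
      using gen[of "Field r"] by simp
  next
    (* If b is not the maximum, then the segment up to b is the open ray below its successor. *)
    case False
    then obtain d where "d \<in> Field r" "d \<noteq> b" "(b, d) \<in> r"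
      by (auto simp: aboveS_def intro: FieldI2)
    then have above: "AboveS r {b} \<noteq> {}"
      by (auto simp: AboveS_def)
    define c where "c = wo_rel.suc r {b}"
    have c: "c \<in> Field r" "b \<in> underS r c"
      using wo_rel.suc_inField[OF wo _ above] wo_rel.suc_greater[OF wo _ above, of b] b
      by (auto simp: c_def underS_def)
    have "under r b = underS r c"
    proof
      show "under r b \<subseteq> underS r c"
        using c ANTISYM transD[OF TRANS]
        unfolding under_def underS_def antisym_def by blast
      show "underS r c \<subseteq> under r b"
      proof
        fix a assume a: "a \<in> underS r c"
        show "a \<in> under r b"
        proof (rule ccontr)
          assume "a \<notin> under r b"
          then have "a \<in> aboveS r b"
            using compl a by (auto simp: underS_def intro: FieldI1)
          then have "(c, a) \<in> r"
            unfolding c_def by (intro wo_rel.suc_least_AboveS[OF wo]) (auto simp: AboveS_def aboveS_def intro: FieldI2)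
          then show False
            using a ANTISYM by (auto simp: underS_def antisym_def)
        qed
      qed
    qed
    then show ?thesis
      using gen[of "underS r c"] c by auto
  qed
qed

text \<open>The intervals \<open>(a, x]\<close> and \<open>[0, x]\<close> form a neighbourhood base at \<open>x\<close>.\<close>

lemma clopen_interval_base:
  assumes "Well_order r" and "openin (rel_order_topology r) U" and "x \<in> U"
  shows "under r x \<subseteq> U \<or> (\<exists>a\<in>underS r x. under r x - under r a \<subseteq> U)"
proof -
  have wo: "wo_rel r"
    using assms(1) by (simp add: wo_rel_def)
  note TOTALS = wo_rel.TOTALS[OF wo] and ANTISYM = wo_rel.ANTISYM[OF wo] and REFL = wo_rel.REFL[OF wo] and TRANS = wo_rel.TRANS[OF wo]
  have "generate_topology_on
     ({Field r} \<union> {underS r a |a. a \<in> Field r} \<union> {aboveS r a |a. a \<in> Field r}) U"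
    using assms(2) unfolding rel_order_topology_def openin_topology_generated_by_iff .
  then show ?thesis
    using \<open>x \<in> U\<close>
  proof (induction arbitrary: x)
    case Empty
    then show ?case by simp
  next
    case (Int S T)
    have mono: "under r a \<subseteq> under r b" if "(a, b) \<in> r" for a b
      using that transD[OF TRANS] unfolding under_def by blast
    have "x \<in> S" "x \<in> T"
      using Int.prems by auto
    from Int.IH(1)[OF \<open>x \<in> S\<close>] Int.IH(2)[OF \<open>x \<in> T\<close>]
    consider "under r x \<subseteq> S \<or> under r x \<subseteq> T"
      | a b where "a \<in> underS r x" "under r x - under r a \<subseteq> S"
          "b \<in> underS r x" "under r x - under r b \<subseteq> T"
      by blast
    then show ?case
    proof cases
      case 1
      with Int.IH(1)[OF \<open>x \<in> S\<close>] Int.IH(2)[OF \<open>x \<in> T\<close>] show ?thesis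
        by (elim disjE bexE) blast+
    next
      case 2
      then have "a \<in> Field r" "b \<in> Field r"
        by (auto simp: underS_def intro: FieldI1)
      (* The interval from the larger of the two left end points lies in both sets. *)
      then have "under r a \<subseteq> under r b \<or> under r b \<subseteq> under r a"
        using TOTALS mono by blast
      then have "under r x - under r b \<subseteq> S \<inter> T \<or> under r x - under r a \<subseteq> S \<inter> T"
        using 2(2,4) by auto
      then show ?thesis
        using 2(1,3) by metis
    qed
  next
    case (UN K)
    then obtain k where "k \<in> K" "x \<in> k"
      by blast
    then show ?case
      using UN.IH[of k x] by blast
  next
    case (Basis S)
    then consider "S = Field r" | c where "S = underS r c" | c where "S = aboveS r c"
      by blast
    then show ?case
    proof cases
      case 1
      then show ?thesis
        by (simp add: under_Field)
    next
      case 2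
      then have "under r x \<subseteq> S"
        using Basis.prems ANTISYM transD[OF TRANS]
        unfolding under_def underS_def antisym_def by blast
      then show ?thesis ..
    next
      case 3
      then have "c \<in> underS r x"
        using Basis.prems by (auto simp: underS_def aboveS_def)
      moreover have "under r x - under r c \<subseteq> S"
      proof
        fix y assume y: "y \<in> under r x - under r c"
        then have "y \<in> Field r" "c \<in> Field r"
          using \<open>c \<in> underS r x\<close> by (auto simp: under_def underS_def intro: FieldI1)
        then show "y \<in> S"
          using y 3 TOTALS refl_onD[OF REFL] unfolding under_def aboveS_def by blast
      qed
      ultimately show ?thesis by blast
    qed
  qed
qed

theorem mainTheorem11:
  fixes r :: "'a rel"
  assumes "Well_order r"
    and "countable (Field r)"
    and "Field r \<noteq> {}"
  shows "CT3 (rel_order_topology r)"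
proof (rule CT3_if_countable_clopen_base)
  have wo: "wo_rel r"
    using assms(1) by (simp add: wo_rel_def)
  note ANTISYM = wo_rel.ANTISYM[OF wo] and REFL = wo_rel.REFL[OF wo]
  let ?X = "rel_order_topology r"
  let ?B = "under r ` Field r \<union> (\<lambda>(x, a). under r x - under r a) ` (Field r \<times> Field r)"
  show "countable ?B"
    using assms(2) by simp
  show "openin ?X V \<and> closedin ?X V" if "V \<in> ?B" for V
    using that clopen_under[OF assms(1)] by (auto intro: openin_diff closedin_diff)
  show "\<exists>V\<in>?B. x \<in> V \<and> V \<subseteq> U" if U: "openin ?X U" "x \<in> U" for U x
  proof -
    have x: "x \<in> Field r"
      using openin_subset[OF U(1)] U(2) by (auto simp: topspace_rel_order_topology)
    then have "(x, x) \<in> r"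
      using REFL by (simp add: refl_on_def)
    then have xx: "x \<in> under r x"
      by (simp add: under_def)
    from clopen_interval_base[OF assms(1) U] show ?thesis
    proof
      assume "under r x \<subseteq> U"
      then show ?thesis
        using x xx by blast
    next
      assume "\<exists>a\<in>underS r x. under r x - under r a \<subseteq> U"
      then obtain a where a: "a \<in> underS r x" "under r x - under r a \<subseteq> U"
        by blast
      then have "x \<notin> under r a" "a \<in> Field r"
        using ANTISYM by (auto simp: under_def underS_def antisym_def intro: FieldI1)
      then show ?thesis
        using a(2) x xx by (intro bexI[of _ "under r x - under r a"]) auto
    qed
  qed
qed

end
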